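(* Let $\mathbb{F}$ be a field of characteristic $0$, let $n\ge 1$, and let $B$ be a nilpotent $n\times n$ matrix over $\mathbb{F}$ with $\dim\ker B=1$. Then $$\mathcal{P}(\mathcal{N}_B)=\mathcal{R}(n),$$ i.e. the set of shapes of nilpotent $n\times n$ matrices over $\mathbb{F}$ commuting with $B$ is exactly $\{r(n,t) : t=1,2,\ldots,n\}$.
   Context: The shape $\operatorname{sh}(A)$ of a nilpotent $n\times n$ matrix $A$ is the partition of $n$ formed by the sizes of the Jordan blocks of $A$ in non-increasing order. $\mathcal{N}_B$ is the set of all nilpotent $n\times n$ matrices $A$ over $\mathbb{F}$ with $AB=BA$, and $\mathcal{P}(\mathcal{N}_B)=\{\operatorname{sh}(A) : A\in\mathcal{N}_B\}$. For $t=1,\ldots,n$, $r(n,t)=(\lambda_1,\ldots,\lambda_t)$ is the unique partition of $n$ into exactly $t$ positive parts $\lambda_1\ge\cdots\ge\lambda_t$ with $\lambda_1-\lambda_t\le 1$. $\mathcal{R}(n)=\{r(n,t) : t=1,2,\ldots,n\}$. *)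

theory Defs
  imports "Jordan_Normal_Form.Jordan_Normal_Form_Uniqueness"
begin

definition nilpotent_mat :: "'a :: semiring_1 mat \<Rightarrow> bool" where
  "nilpotent_mat A \<longleftrightarrow> square_mat A \<and> (\<exists>k. A ^\<^sub>m k = 0\<^sub>m (dim_row A) (dim_row A))"

(* Partitions are lists of positive parts in non-increasing order. *)
definition is_partition_of :: "nat \<Rightarrow> nat list \<Rightarrow> bool" where
  "is_partition_of n p \<longleftrightarrow> sorted_wrt (\<ge>) p \<and> 0 \<notin> set p \<and> sum_list p = n"

(* The list of Jordan blocks (size, eigenvalue) of a matrix is determined only up to order;
   sorting the sizes makes the shape unique, see shape_eqI. *)
definition shape :: "'a :: field mat \<Rightarrow> nat list" where
  "shape A = (THE p. \<exists>n_as. jordan_nf A n_as \<and> p = rev (sort (map fst n_as)))"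

definition nilpotent_commutator :: "nat \<Rightarrow> 'a :: field mat \<Rightarrow> 'a mat set" where
  "nilpotent_commutator n B = {A \<in> carrier_mat n n. nilpotent_mat A \<and> A * B = B * A}"

(* Intended for 1 <= t <= n, where ex1_almost_equal_partition applies. *)
definition almost_equal_partition :: "nat \<Rightarrow> nat \<Rightarrow> nat list" where
  "almost_equal_partition n t =
     (THE p. is_partition_of n p \<and> length p = t \<and> hd p \<le> last p + 1)"

definition almost_equal_partitions :: "nat \<Rightarrow> nat list set" where
  "almost_equal_partitions n = almost_equal_partition n ` {1..n}"

lemma jordan_nf_mset_unique:
  fixes A :: "'a :: field mat"
  assumes "jordan_nf A xs" "jordan_nf A ys"
  shows "mset xs = mset ys"
proof (rule multiset_eqI)
  fix z :: "nat \<times> 'a"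
  obtain k e where z: "z = (k, e)" by (cases z)
  show "count (mset xs) z = count (mset ys) z"
  proof (cases "k = 0")
    case True
    then have "z \<notin> set xs" "z \<notin> set ys"
      using assms unfolding jordan_nf_def z by force+
    then show ?thesis by (metis count_mset_0_iff)
  next
    case False
    have "count (mset zs) z = length (filter ((=) (k, e)) zs)" for zs
      by (induction zs) (auto simp: z)
    then show ?thesis
      using compute_nr_of_jordan_blocks[OF assms(1) False, of e]
        compute_nr_of_jordan_blocks[OF assms(2) False, of e] by simp
  qed
qed

lemma shape_eqI:
  assumes "jordan_nf A n_as"
  shows "shape A = rev (sort (map fst n_as))"
  unfolding shape_def
proof (rule the_equality)
  fix p assume "\<exists>m_as. jordan_nf A m_as \<and> p = rev (sort (map fst m_as))"
  then obtain m_as where m: "jordan_nf A m_as" "p = rev (sort (map fst m_as))" by blast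
  have "mset (map fst m_as) = mset (map fst n_as)"
    using jordan_nf_mset_unique[OF m(1) assms] by (metis mset_map)
  then have "sort (map fst m_as) = sort (map fst n_as)"
    by (metis properties_for_sort mset_sort sorted_sort)
  then show "p = rev (sort (map fst n_as))" using m(2) by simp
qed (use assms in blast)

lemma ex1_almost_equal_partition:
  assumes "1 \<le> t" "t \<le> n"
  shows "\<exists>!p. is_partition_of n p \<and> length p = t \<and> hd p \<le> last p + 1"
proof -
  define q where "q = n div t"
  define r where "r = n mod t"
  define p0 where "p0 = replicate r (Suc q) @ replicate (t - r) q"
  have r: "r < t" using assms by (simp add: r_def)
  have q: "q \<ge> 1" using assms by (simp add: q_def Suc_le_eq div_greater_zero_iff)
  have n: "n = t * q + r" by (simp add: q_def r_def)
  show ?thesis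
  proof (rule ex1I[of _ p0], intro conjI)
    have "sorted_wrt (\<ge>) (replicate m x)" for m and x :: nat
      by (induction m) auto
    then have "sorted_wrt (\<ge>) p0" unfolding p0_def by (auto simp: sorted_wrt_append)
    moreover have "sum_list p0 = n"
    proof -
      have "sum_list p0 = r * Suc q + (t - r) * q" by (simp add: p0_def sum_list_replicate)
      also have "\<dots> = r + (r + (t - r)) * q" by (simp only: algebra_simps mult_Suc_right)
      also have "r + (t - r) = t" using r by simp
      finally show ?thesis using n by simp
    qed
    ultimately show "is_partition_of n p0"
      using q by (auto simp: is_partition_of_def p0_def)
    show "length p0 = t" using r by (simp add: p0_def)
    have "last p0 = q" using r by (simp add: p0_def)
    moreover have "hd p0 \<le> Suc q" using r by (cases r) (simp_all add: p0_def hd_replicate)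
    ultimately show "hd p0 \<le> last p0 + 1" by simp
  next
    fix p assume p: "is_partition_of n p \<and> length p = t \<and> hd p \<le> last p + 1"
    define l where "l = last p"
    define a where "a = length (filter (\<lambda>x. x = Suc l) p)"
    have ne: "p \<noteq> []" using p assms by auto
    have srt: "sorted_wrt (\<ge>) p" using p by (simp add: is_partition_of_def)
    have ge: "l \<le> x" "x \<le> Suc l" if "x \<in> set p" for x
    proof -
      have "p = butlast p @ [l]" using ne by (simp add: l_def)
      then have "sorted_wrt (\<ge>) (butlast p @ [l])" using srt by simp
      then have "\<forall>y\<in>set (butlast p). l \<le> y" by (simp add: sorted_wrt_append)
      moreover have "x \<in> set (butlast p) \<or> x = l"
        using that \<open>p = butlast p @ [l]\<close> by (metis Un_iff empty_iff insert_iff list.set set_append)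
      ultimately show "l \<le> x" by auto
      have "p = hd p # tl p" using ne by simp
      then have "sorted_wrt (\<ge>) (hd p # tl p)" using srt by simp
      then have "\<forall>y\<in>set (tl p). y \<le> hd p" by simp
      moreover have "x = hd p \<or> x \<in> set (tl p)"
        using that \<open>p = hd p # tl p\<close> by (metis set_ConsD)
      ultimately show "x \<le> Suc l" using p l_def by force
    qed
    have form: "xs = replicate (length (filter (\<lambda>x. x = Suc l) xs)) (Suc l)
                  @ replicate (length xs - length (filter (\<lambda>x. x = Suc l) xs)) l"
      if "sorted_wrt (\<ge>) xs" "\<And>x. x \<in> set xs \<Longrightarrow> l \<le> x \<and> x \<le> Suc l" for xs
      using that
    proof (induction xs)
      case (Cons x xs)
      show ?case
      proof (cases "x = Suc l")
        case True
        then show ?thesis using Cons by simp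
      next
        case False
        then have "x = l" using Cons.prems(2)[of x] by simp
        then have all: "\<forall>y\<in>set (x # xs). y = l" using Cons.prems by fastforce
        then have "filter (\<lambda>x. x = Suc l) (x # xs) = []" by (auto simp: filter_empty_conv)
        moreover have "x # xs = replicate (length (x # xs)) l"
          using all by (metis replicate_length_same)
        ultimately show ?thesis by simp
      qed
    qed simp
    have pa: "p = replicate a (Suc l) @ replicate (t - a) l"
      using form[OF srt] ge p unfolding a_def by blast
    have at: "a < t"
    proof -
      have "last p \<noteq> Suc l" "last p \<in> set p" using ne by (auto simp: l_def)
      then have "a < length p" unfolding a_def by (rule_tac length_filter_less) auto
      then show ?thesis using p by simp
    qed
    have "n = sum_list p" using p by (simp add: is_partition_of_def)
    also have "\<dots> = a * Suc l + (t - a) * l" by (subst pa) (simp add: sum_list_replicate)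
    also have "\<dots> = a + (a + (t - a)) * l" by (simp only: algebra_simps mult_Suc_right)
    also have "a + (t - a) = t" using at by simp
    finally have n': "n = a + t * l" .
    have "q = l" "r = a" using at unfolding n' q_def r_def by simp_all
    then show "p = p0" using pa by (simp add: p0_def)
  qed
qed

end

theory Submission
  imports Defs "Jordan_Normal_Form.Jordan_Normal_Form_Existence"
begin

text \<open>Since the kernel of \<open>B\<close> is a line, the only \<open>B\<close>-invariant subspaces are the kernels of powers
  of \<open>B\<close>. If \<open>A\<close> commutes with \<open>B\<close>, then \<open>ker A\<close> is invariant, so \<open>ker A = ker B\<^sup>t\<close> for some \<open>t\<close>,
  and commuting once more gives \<open>ker A\<^sup>k = ker B\<^sup>t\<^sup>k\<close>, of dimension \<open>min (t k) n\<close>. For nilpotent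
  \<open>A\<close> with block sizes \<open>x\<close>, the dimension of \<open>ker A\<^sup>k\<close> is the sum of all \<open>min k x\<close>. At \<open>k = 1\<close> this
  says that there are \<open>min t n\<close> blocks; at one more than the smallest block size the sum falls
  short of \<open>t k\<close>, hence equals \<open>n\<close>, so no block is larger than that. Conversely the powers of \<open>B\<close>
  realise every number of blocks.\<close>

section \<open>Matrix powers and their action on vectors\<close>

lemma mult_mat_zero_vec:
  "A \<in> carrier_mat nr nc \<Longrightarrow> A *\<^sub>v 0\<^sub>v nc = (0\<^sub>v nr :: 'a :: comm_ring_1 vec)"
  by auto

lemma pow_mat_mult_vec_Suc:
  fixes A :: "'a :: comm_ring_1 mat"
  assumes "A \<in> carrier_mat n n" "v \<in> carrier_vec n"
  shows "A ^\<^sub>m Suc k *\<^sub>v v = A ^\<^sub>m k *\<^sub>v (A *\<^sub>v v)"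
  using assms by (simp add: assoc_mult_mat_vec[OF pow_carrier_mat])

lemma pow_mat_mult_vec_add:
  fixes A :: "'a :: comm_ring_1 mat"
  assumes "A \<in> carrier_mat n n" "v \<in> carrier_vec n"
  shows "A ^\<^sub>m (j + k) *\<^sub>v v = A ^\<^sub>m j *\<^sub>v (A ^\<^sub>m k *\<^sub>v v)"
  using assms(2)
proof (induction k arbitrary: v)
  case (Suc k)
  then have "A *\<^sub>v v \<in> carrier_vec n" using assms(1) by simp
  then show ?case
    using Suc assms(1) by (simp only: add_Suc_right pow_mat_mult_vec_Suc)
qed (use assms in simp)

lemma pow_mat_pow:
  fixes A :: "'a :: comm_ring_1 mat"
  assumes A: "A \<in> carrier_mat n n"
  shows "(A ^\<^sub>m t) ^\<^sub>m k = A ^\<^sub>m (t * k)"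
proof -
  \<comment> \<open>On square matrices \<open>^\<^sub>m\<close> is the power operation of the matrix
    ring, so the ring law \<open>nat_pow_pow\<close> carries over.\<close>
  interpret ring "ring_mat TYPE('a) n ()" by (rule ring_mat)
  have "A \<in> carrier (ring_mat TYPE('a) n ())" using A by (simp add: ring_mat_simps)
  then show ?thesis
    using nat_pow_pow[of A t k] pow_mat_ring_pow[OF A, of t "()"] pow_mat_ring_pow[OF A, of "t * k" "()"]
      pow_mat_ring_pow[OF pow_carrier_mat[OF A], of t k "()"]
    by simp
qed

lemma pow_mat_commute_vec:
  fixes A :: "'a :: comm_ring_1 mat"
  assumes A: "A \<in> carrier_mat n n" and B: "B \<in> carrier_mat n n" and AB: "A * B = B * A"
    and v: "v \<in> carrier_vec n"
  shows "A *\<^sub>v (B ^\<^sub>m k *\<^sub>v v) = B ^\<^sub>m k *\<^sub>v (A *\<^sub>v v)"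
  using v
proof (induction k arbitrary: v)
  case (Suc k)
  have "A *\<^sub>v (B *\<^sub>v v) = B *\<^sub>v (A *\<^sub>v v)"
    using AB assoc_mult_mat_vec[OF A B Suc.prems] assoc_mult_mat_vec[OF B A Suc.prems] by simp
  moreover have "A *\<^sub>v v \<in> carrier_vec n" "B *\<^sub>v v \<in> carrier_vec n" using A B Suc.prems by auto
  ultimately show ?case using Suc.IH B Suc.prems by (simp only: pow_mat_mult_vec_Suc)
qed (use A B in simp)

lemma pow_mat_comm:
  fixes A :: "'a :: comm_ring_1 mat"
  assumes "A \<in> carrier_mat n n"
  shows "A ^\<^sub>m k * A = A * A ^\<^sub>m k"
  using assms
  by (induction k) (auto simp: assoc_mult_mat[of _ n n _ n _ n])

section \<open>Kernels of matrices commuting with \<open>B\<close>\<close>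

lemma kernel_dim_cong:
  assumes "dim_col A = dim_col B" "mat_kernel A = mat_kernel B"
  shows "kernel_dim A = kernel_dim B"
  using assms by (simp add: kernel_dim_def)

lemma kernel_dim_1_imp_line:
  fixes B :: "'a :: field mat"
  assumes B: "B \<in> carrier_mat m n" and dim: "kernel_dim B = 1"
    and x: "x \<in> mat_kernel B" "x \<noteq> 0\<^sub>v n" and y: "y \<in> mat_kernel B"
  shows "\<exists>c. y = c \<cdot>\<^sub>v x"
proof -
  interpret K: kernel m n B by unfold_locales (rule B)
  obtain b where b: "finite b" "K.basis b" using kernel_basis_exists[OF B] by blast
  then have "card b = 1" using dim K.Ker.dim_basis by simp
  then obtain u where u: "b = {u}" by (auto simp: card_1_singleton_iff)
  have uK: "u \<in> mat_kernel B" and sp: "K.span {u} = mat_kernel B"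
    using b(2) unfolding u K.Ker.basis_def by auto
  have "\<exists>c. z = c \<cdot>\<^sub>v u" if "z \<in> mat_kernel B" for z
  proof -
    have "z \<in> K.span {u}" using that sp by simp
    then obtain a where "z = K.lincomb a {u}"
      using K.Ker.finite_span[of "{u}"] uK by auto
    then show ?thesis using uK mat_kernel_smult[OF B uK] by (auto simp: K.Ker.lincomb_def)
  qed
  then obtain c d where "x = c \<cdot>\<^sub>v u" "y = d \<cdot>\<^sub>v u" using x y by blast
  \<comment> \<open>With \<open>c = 0\<close> the vector \<open>x\<close> would vanish; hence
    \<open>u\<close>, and with it \<open>y\<close>, is a multiple of \<open>x\<close>.\<close>
  moreover have "c \<noteq> 0" using calculation x mat_kernelD[OF B uK] by auto
  ultimately have "y = (d / c) \<cdot>\<^sub>v x" by (simp add: smult_smult_assoc)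
  then show ?thesis ..
qed

text \<open>Take the least \<open>t\<close> for which the kernel of \<open>A\<close> lies in that of
  \<open>B ^\<^sub>m t\<close>. For \<open>t > 0\<close>, minimality yields an \<open>x\<close> in
  the kernel of \<open>A\<close> that survives \<open>B ^\<^sub>m (t - 1)\<close>. The images of
  \<open>x\<close> under powers of \<open>B\<close> stay in the kernel of \<open>A\<close> by
  commutation, and they span the kernel of \<open>B ^\<^sub>m t\<close>.\<close>

lemma commuting_kernel_eq_pow_kernel:
  fixes A B :: "'a :: field mat"
  assumes A: "A \<in> carrier_mat n n" and B: "B \<in> carrier_mat n n" and AB: "A * B = B * A"
    and nil: "nilpotent_mat B" and dim: "kernel_dim B = 1"
  obtains t where "\<And>v. v \<in> carrier_vec n \<Longrightarrow> A *\<^sub>v v = 0\<^sub>v n \<longleftrightarrow> B ^\<^sub>m t *\<^sub>v v = 0\<^sub>v n"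
proof -
  define P where "P t \<longleftrightarrow> (\<forall>v\<in>carrier_vec n. A *\<^sub>v v = 0\<^sub>v n \<longrightarrow> B ^\<^sub>m t *\<^sub>v v = 0\<^sub>v n)" for t
  define t where "t = (LEAST t. P t)"
  obtain k where "B ^\<^sub>m k = 0\<^sub>m n n" using nil B by (auto simp: nilpotent_mat_def)
  \<comment> \<open>A vanishing power of \<open>B\<close> kills everything, so the least exponent
    exists.\<close>
  then have "P k" by (auto simp: P_def)
  then have Pt: "P t" unfolding t_def by (rule LeastI)
  note carr = mult_mat_vec_carrier[OF pow_carrier_mat[OF B]]
  have "A *\<^sub>v y = 0\<^sub>v n" if y: "y \<in> carrier_vec n" "B ^\<^sub>m t *\<^sub>v y = 0\<^sub>v n" for y
  proof (cases t)
    case 0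
    then show ?thesis using that A B by auto
  next
    case (Suc s)
    then have "\<not> P s" unfolding t_def using not_less_Least by (metis lessI)
    then obtain x where x: "x \<in> carrier_vec n" "A *\<^sub>v x = 0\<^sub>v n" "B ^\<^sub>m s *\<^sub>v x \<noteq> 0\<^sub>v n"
      by (auto simp: P_def)
    have "B ^\<^sub>m (1 + s) *\<^sub>v x = 0\<^sub>v n" using Pt x Suc by (simp add: P_def)
    \<comment> \<open>This nonzero vector spans the line that is the kernel of
      \<open>B\<close>.\<close>
    then have xs: "B ^\<^sub>m s *\<^sub>v x \<in> mat_kernel B"
      using pow_mat_mult_vec_add[OF B x(1), of 1 s] carr[OF x(1)] B by (auto intro!: mat_kernelI)
    (* Subtracting a multiple of some B-power of x, which lies in ker A, lowers the order of y. *)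
    have "A *\<^sub>v y = 0\<^sub>v n" if "j \<le> Suc s" "y \<in> carrier_vec n" "B ^\<^sub>m j *\<^sub>v y = 0\<^sub>v n" for j y
      using that
    proof (induction j arbitrary: y)
      case 0
      then show ?case using A B by auto
    next
      case (Suc j)
      have "B ^\<^sub>m j *\<^sub>v y \<in> mat_kernel B"
        using pow_mat_mult_vec_add[OF B Suc.prems(2), of 1 j] carr[OF Suc.prems(2)] B Suc.prems(3)
        by (auto intro!: mat_kernelI)
      then obtain c where c: "B ^\<^sub>m j *\<^sub>v y = c \<cdot>\<^sub>v (B ^\<^sub>m s *\<^sub>v x)"
        using kernel_dim_1_imp_line[OF B dim xs x(3)] by blast
      \<comment> \<open>Since \<open>j \<le> s\<close>, applying \<open>B ^\<^sub>m j\<close> to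
        \<open>w\<close> gives \<open>c \<cdot>\<^sub>v (B ^\<^sub>m s *\<^sub>v x)\<close>, which
        is \<open>B ^\<^sub>m j *\<^sub>v y\<close>. So \<open>y - w\<close> falls under the
        induction hypothesis.\<close>
      define w where "w = c \<cdot>\<^sub>v (B ^\<^sub>m (s - j) *\<^sub>v x)"
      have w: "w \<in> carrier_vec n" using carr[OF x(1)] by (simp add: w_def)
      have Aw: "A *\<^sub>v w = 0\<^sub>v n"
      proof -
        have "A *\<^sub>v (B ^\<^sub>m (s - j) *\<^sub>v x) = B ^\<^sub>m (s - j) *\<^sub>v 0\<^sub>v n"
          using pow_mat_commute_vec[OF A B AB x(1)] x(2) by simp
        also have "\<dots> = 0\<^sub>v n" by (rule mult_mat_zero_vec[OF pow_carrier_mat[OF B]])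
        finally have "A *\<^sub>v w = c \<cdot>\<^sub>v 0\<^sub>v n" using mult_mat_vec[OF A carr[OF x(1)]] by (simp add: w_def)
        then show ?thesis by auto
      qed
      have "B ^\<^sub>m j *\<^sub>v w = B ^\<^sub>m j *\<^sub>v y"
        using pow_mat_mult_vec_add[OF B x(1), of j "s - j"] c Suc.prems(1) carr[OF x(1)]
        by (simp add: w_def mult_mat_vec[OF pow_carrier_mat[OF B]])
      then have "B ^\<^sub>m j *\<^sub>v (y - w) = 0\<^sub>v n"
        using mult_minus_distrib_mat_vec[OF pow_carrier_mat[OF B] Suc.prems(2) w]
          minus_cancel_vec[OF carr[OF Suc.prems(2)]] by simp
      then have "A *\<^sub>v (y - w) = 0\<^sub>v n" using Suc w by simp
      then have "A *\<^sub>v y - 0\<^sub>v n = 0\<^sub>v n"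
        using mult_minus_distrib_mat_vec[OF A Suc.prems(2) w] Aw by simp
      then show ?case using A Suc.prems(2) by simp
    qed
    then show ?thesis using y Suc by blast
  qed
  with Pt that[of t] show ?thesis unfolding P_def by blast
qed

text \<open>In the induction, one factor \<open>A\<close> is moved past
  \<open>B ^\<^sub>m (t * k)\<close>, where \<open>ker\<close> trades it for
  \<open>B ^\<^sub>m t\<close>.\<close>

lemma commuting_pow_kernel:
  fixes A B :: "'a :: comm_ring_1 mat"
  assumes A: "A \<in> carrier_mat n n" and B: "B \<in> carrier_mat n n" and AB: "A * B = B * A"
    and ker: "\<And>v. v \<in> carrier_vec n \<Longrightarrow> A *\<^sub>v v = 0\<^sub>v n \<longleftrightarrow> B ^\<^sub>m t *\<^sub>v v = 0\<^sub>v n"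
  shows "mat_kernel (A ^\<^sub>m k) = mat_kernel (B ^\<^sub>m (t * k))"
proof -
  have "A ^\<^sub>m k *\<^sub>v v = 0\<^sub>v n \<longleftrightarrow> B ^\<^sub>m (t * k) *\<^sub>v v = 0\<^sub>v n" if "v \<in> carrier_vec n" for v
    using that
  proof (induction k arbitrary: v)
    case (Suc k)
    note carr = mult_mat_vec_carrier[OF pow_carrier_mat[OF B] Suc.prems]
    have "A ^\<^sub>m Suc k *\<^sub>v v = 0\<^sub>v n \<longleftrightarrow> B ^\<^sub>m (t * k) *\<^sub>v (A *\<^sub>v v) = 0\<^sub>v n"
      using pow_mat_mult_vec_Suc[OF A Suc.prems] Suc.IH A Suc.prems by simp
    also have "\<dots> \<longleftrightarrow> B ^\<^sub>m t *\<^sub>v (B ^\<^sub>m (t * k) *\<^sub>v v) = 0\<^sub>v n"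
      using pow_mat_commute_vec[OF A B AB Suc.prems] ker[OF carr] by simp
    finally show ?case using pow_mat_mult_vec_add[OF B Suc.prems, of t "t * k"] by simp
  qed (use A B in simp)
  then show ?thesis
    using mat_kernel[OF pow_carrier_mat[OF A]] mat_kernel[OF pow_carrier_mat[OF B]] by auto
qed

section \<open>Triangular and Jordan forms of nilpotent matrices\<close>

lemma nilpotent_mat_similar:
  assumes "similar_mat A B" "nilpotent_mat A"
  shows "nilpotent_mat B"
proof -
  obtain P Q where wit: "similar_mat_wit B A P Q"
    using similar_mat_sym[OF assms(1)] unfolding similar_mat_def by blast
  define n where "n = dim_row B"
  note d = similar_mat_witD[OF n_def wit]
  obtain k where k: "A ^\<^sub>m k = 0\<^sub>m n n" using assms(2) d by (auto simp: nilpotent_mat_def)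
  have "B ^\<^sub>m k = 0\<^sub>m n n" using similar_mat_wit_pow_id[OF wit, of k] k d by simp
  then show ?thesis using d by (auto simp: nilpotent_mat_def)
qed

text \<open>Diagonal blocks multiply independently of the corner, which may therefore stay
  unspecified. This passes nilpotency on to the leading block.\<close>

lemma pow_upper_block:
  fixes A :: "'a :: comm_ring_1 mat"
  assumes A: "A \<in> carrier_mat n n" and B: "B \<in> carrier_mat n m" and D: "D \<in> carrier_mat m m"
  shows "\<exists>C \<in> carrier_mat n m. four_block_mat A B (0\<^sub>m m n) D ^\<^sub>m k
    = four_block_mat (A ^\<^sub>m k) C (0\<^sub>m m n) (D ^\<^sub>m k)"
proof (induction k)
  case 0
  have "1\<^sub>m (n + m) = four_block_mat (1\<^sub>m n) (0\<^sub>m n m) (0\<^sub>m m n) (1\<^sub>m m)"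
    by (intro eq_matI) auto
  then show ?case using A D by (intro bexI[of _ "0\<^sub>m n m"]) auto
next
  case (Suc k)
  then obtain C where C: "C \<in> carrier_mat n m" and
    eq: "four_block_mat A B (0\<^sub>m m n) D ^\<^sub>m k = four_block_mat (A ^\<^sub>m k) C (0\<^sub>m m n) (D ^\<^sub>m k)"
    by blast
  \<comment> \<open>Multiplying block matrices leaves zero summands on the diagonal; they are
    cleared below.\<close>
  have Ak: "A ^\<^sub>m k \<in> carrier_mat n n" and Dk: "D ^\<^sub>m k \<in> carrier_mat m m" using A D by auto
  have "A ^\<^sub>m k * A + 0\<^sub>m n n = A ^\<^sub>m k * A" "0\<^sub>m m m + D ^\<^sub>m k * D = D ^\<^sub>m k * D"
    using mult_carrier_mat[OF Ak A] mult_carrier_mat[OF Dk D]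
    by (simp_all add: right_add_zero_mat left_add_zero_mat)
  then show ?case
    using A B C D
    by (intro bexI[of _ "A ^\<^sub>m k * B + C * D"])
      (simp_all add: eq mult_four_block_mat[OF Ak C zero_carrier_mat Dk A B zero_carrier_mat D])
qed

(* The library's Schur decomposition needs a conjugation on the field. Over an arbitrary field,
   conjugating by the row operations that bring A into row echelon form clears the last row. *)
lemma nilpotent_mat_triangularizable:
  fixes A :: "'a :: field mat"
  assumes "A \<in> carrier_mat n n" "nilpotent_mat A"
  shows "\<exists>T \<in> carrier_mat n n. upper_triangular T \<and> similar_mat A T"
  using assms
proof (induction n arbitrary: A)
  case 0
  then show ?case by (intro bexI[of _ A]) (auto intro: similar_mat_refl)
next
  case (Suc m)
  let ?n = "Suc m"
  note A = Suc.prems(1)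
  obtain k where k: "A ^\<^sub>m k = 0\<^sub>m ?n ?n" using Suc.prems by (auto simp: nilpotent_mat_def)
  define C where "C = gauss_jordan_single A"
  obtain P Q where C: "C \<in> carrier_mat ?n ?n" "row_echelon_form C" "C = P * A"
    and P: "P \<in> carrier_mat ?n ?n" and Q: "Q \<in> carrier_mat ?n ?n"
    and PQ: "P * Q = 1\<^sub>m ?n" "Q * P = 1\<^sub>m ?n"
    using gauss_jordan_single[OF A C_def[symmetric]] by blast
  have "det A = 0"
  proof -
    have "det (A ^\<^sub>m j) = det A ^ j" for j
      by (induction j) (use A det_mult[OF pow_carrier_mat[OF A] A] in auto)
    then have "det A ^ k = 0" using k by (metis det_zero zero_less_Suc)
    then show ?thesis by simp
  qed
  \<comment> \<open>\<open>C = P * A\<close> is singular, and a square row echelon form other than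
    the identity has zero last row.\<close>
  then have "C \<noteq> 1\<^sub>m ?n" using det_mult[OF P A] C(3) by auto
  then have row: "row C m = 0\<^sub>v ?n" using row_echelon_form_imp_1_or_0_row[OF C(1,2)] by auto
  \<comment> \<open>As \<open>Q\<close> inverts \<open>P\<close>, this is the conjugate
    \<open>P * A * Q\<close>; right multiplication by \<open>Q\<close> keeps the last row
    zero.\<close>
  define A' where "A' = C * Q"
  have A': "A' \<in> carrier_mat ?n ?n" using C Q by (simp add: A'_def)
  have row': "A' $$ (m, j) = 0" if "j < ?n" for j
    using that C(1) Q row by (auto simp: A'_def)
  have simA: "similar_mat A' A"
    unfolding similar_mat_def
    by (rule exI[of _ P], rule exI[of _ Q], rule similar_mat_witI[OF PQ _ A' A P Q])
      (simp add: A'_def C)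
  define U where "U = mat m m (\<lambda>(i, j). A' $$ (i, j))"
  define b where "b = mat m 1 (\<lambda>(i, j). A' $$ (i, m))"
  have U: "U \<in> carrier_mat m m" and b: "b \<in> carrier_mat m 1" by (auto simp: U_def b_def)
  let ?Z = "0\<^sub>m 1 1 :: 'a mat"
  have block: "A' = four_block_mat U b (0\<^sub>m 1 m) ?Z"
  proof (rule eq_matI)
    fix i j assume "i < dim_row (four_block_mat U b (0\<^sub>m 1 m) ?Z)"
      "j < dim_col (four_block_mat U b (0\<^sub>m 1 m) ?Z)"
    then have "i < ?n" "j < ?n" using U by auto
    then show "A' $$ (i, j) = four_block_mat U b (0\<^sub>m 1 m) ?Z $$ (i, j)"
      using row' U by (auto simp: U_def b_def less_Suc_eq)
  qed (use A' U in auto)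
  have "nilpotent_mat U"
  proof -
    obtain l where l: "A' ^\<^sub>m l = 0\<^sub>m ?n ?n"
      using nilpotent_mat_similar[OF similar_mat_sym[OF simA] Suc.prems(2)] A'
      by (auto simp: nilpotent_mat_def)
    obtain D where D: "D \<in> carrier_mat m 1"
      "A' ^\<^sub>m l = four_block_mat (U ^\<^sub>m l) D (0\<^sub>m 1 m) (?Z ^\<^sub>m l)"
      using pow_upper_block[OF U b, of ?Z l] block by auto
    have "U ^\<^sub>m l = 0\<^sub>m m m"
    proof (rule eq_matI)
      fix i j assume ij: "i < dim_row (0\<^sub>m m m)" "j < dim_col (0\<^sub>m m m)"
      then have "(U ^\<^sub>m l) $$ (i, j) = (A' ^\<^sub>m l) $$ (i, j)"
        using U unfolding D(2) by (subst index_mat_four_block) auto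
      then show "(U ^\<^sub>m l) $$ (i, j) = 0\<^sub>m m m $$ (i, j)" using l ij by simp
    qed (use U in auto)
    then show ?thesis using U by (auto simp: nilpotent_mat_def)
  qed
  then obtain T where T: "T \<in> carrier_mat m m" "upper_triangular T" "similar_mat U T"
    using Suc.IH[OF U] by blast
  obtain b' where b': "similar_mat A' (four_block_mat T b' (0\<^sub>m 1 m) ?Z)"
    using similar_mat_four_block_0_ex[OF T(3) similar_mat_refl[OF zero_carrier_mat] b U
        zero_carrier_mat, folded block] by blast
  have "upper_triangular (four_block_mat T b' (0\<^sub>m 1 m) ?Z)"
    by (rule upper_triangular_four_block[OF T(1) _ T(2)]) auto
  moreover have "four_block_mat T b' (0\<^sub>m 1 m) ?Z \<in> carrier_mat ?n ?n" using T(1) by auto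
  ultimately show ?case using similar_mat_trans[OF similar_mat_sym[OF simA] b'] by blast
qed

lemma nilpotent_mat_eigenvalue:
  fixes A :: "'a :: field mat"
  assumes A: "A \<in> carrier_mat n n" and nil: "nilpotent_mat A" and ev: "eigenvalue A a"
  shows "a = 0"
proof -
  obtain v where v: "eigenvector A v a" using ev by (auto simp: eigenvalue_def)
  obtain k where "A ^\<^sub>m k = 0\<^sub>m n n" using nil A by (auto simp: nilpotent_mat_def)
  then have "a ^ k \<cdot>\<^sub>v v = 0\<^sub>v n" and nz: "v \<in> carrier_vec n" "v \<noteq> 0\<^sub>v n"
    using eigenvector_pow[OF A v, of k, symmetric] v A by (auto simp: eigenvector_def)
  obtain i where i: "i < n" "v $ i \<noteq> 0" using nz by (metis eq_vecI carrier_vecD index_zero_vec)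
  then have "a ^ k * v $ i = 0"
    using arg_cong[OF \<open>a ^ k \<cdot>\<^sub>v v = 0\<^sub>v n\<close>, of "\<lambda>w. w $ i"] nz by simp
  then show ?thesis using i by simp
qed

text \<open>A triangular form yields a Jordan form, all of whose eigenvalues are 0. The kernel of
  \<open>A ^\<^sub>m k\<close> is then a generalized eigenspace, to which a block of size
  \<open>x\<close> contributes dimension \<open>min k x\<close>.\<close>

lemma nilpotent_mat_shape:
  fixes A :: "'a :: field mat"
  assumes A: "A \<in> carrier_mat n n" and nil: "nilpotent_mat A"
  shows "is_partition_of n (shape A)"
    and "kernel_dim (A ^\<^sub>m k) = (\<Sum>x\<leftarrow>shape A. min k x)"
proof -
  obtain T where T: "T \<in> carrier_mat n n" "upper_triangular T" "similar_mat A T"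
    using nilpotent_mat_triangularizable[OF A nil] by blast
  obtain xs where xs: "jordan_nf A xs"
    using triangular_to_jnf_vector[OF T(1,2)] similar_mat_trans[OF T(3)]
    unfolding jordan_nf_def by blast
  note sh = shape_eqI[OF xs]
  have pos: "0 \<notin> fst ` set xs" using xs by (simp add: jordan_nf_def)
  have ev: "a = 0" if "(m, a) \<in> set xs" for m a
  proof -
    \<comment> \<open>Blocks have positive size, so \<open>a\<close> is a root of its factor of the
      characteristic polynomial.\<close>
    have "m \<noteq> 0" using that pos by force
    then have "poly ([:- a, 1:] ^ m) a = 0" by (simp add: poly_power)
    then have "poly (char_poly A) a = 0"
      unfolding jordan_nf_char_poly[OF xs] poly_prod_list using that
      by (auto simp: prod_list_zero_iff intro!: image_eqI[of _ _ "(m, a)"])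
    then show ?thesis
      using nilpotent_mat_eigenvalue[OF A nil] eigenvalue_root_char_poly[OF A] by blast
  qed
  have "similar_mat A (jordan_matrix xs)" using xs by (simp add: jordan_nf_def)
  then obtain m where "A \<in> carrier_mat m m" "jordan_matrix xs \<in> carrier_mat m m"
    using similar_matD by blast
  then have "dim_row (jordan_matrix xs) = n" using A by (metis carrier_matD(1))
  then have "sum_list (map fst xs) = n" by simp
  moreover have "sum_list (shape A) = sum_list (map fst xs)"
    unfolding sh by (metis mset_rev mset_sort sum_mset_sum_list)
  moreover have "sorted_wrt (\<ge>) (shape A)" by (simp add: sh sorted_wrt_rev)
  ultimately show "is_partition_of n (shape A)"
    using pos by (simp add: is_partition_of_def sh)
  have "mset (map (min k) (shape A)) = mset (map (min k) (map fst xs))" 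
    by (simp add: sh multiset.map_comp)
  then have sums: "(\<Sum>x\<leftarrow>map fst xs. min k x) = (\<Sum>x\<leftarrow>shape A. min k x)"
    by (metis sum_mset_sum_list)
  have "char_matrix A 0 = A" using A by (auto simp: char_matrix_def)
  then have "kernel_dim (A ^\<^sub>m k) = dim_gen_eigenspace A 0 k" by (simp add: dim_gen_eigenspace_def)
  also have "\<dots> = (\<Sum>x\<leftarrow>map fst [(m, e)\<leftarrow>xs. e = 0]. min k x)" by (rule dim_gen_eigenspace[OF xs])
  also have "[(m, e)\<leftarrow>xs. e = 0] = xs" using ev by (auto simp: filter_id_conv)
  also note sums
  finally show "kernel_dim (A ^\<^sub>m k) = (\<Sum>x\<leftarrow>shape A. min k x)" .
qed

section \<open>Recognizing an almost equal partition from its truncated sums\<close>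

lemma sum_list_min_1:
  "0 \<notin> set p \<Longrightarrow> (\<Sum>x\<leftarrow>p. min 1 x) = length p" for p :: "nat list"
  by (induction p) auto

lemma sum_list_mono_strict_ex:
  fixes f g :: "'a \<Rightarrow> nat"
  assumes "\<And>x. x \<in> set xs \<Longrightarrow> f x \<le> g x" "z \<in> set xs" "f z < g z"
  shows "(\<Sum>x\<leftarrow>xs. f x) < (\<Sum>x\<leftarrow>xs. g x)"
  using assms
proof (induction xs)
  case (Cons a xs)
  have le: "(\<Sum>x\<leftarrow>xs. f x) \<le> (\<Sum>x\<leftarrow>xs. g x)" using Cons.prems by (intro sum_list_mono) auto
  show ?case
  proof (cases "z = a")
    case True
    then show ?thesis using le Cons.prems by simp
  next
    case False
    then show ?thesis using Cons by (force intro: add_le_less_mono)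
  qed
qed simp

lemma almost_equal_partitionI:
  assumes p: "is_partition_of n p" and t: "1 \<le> t" "t \<le> n"
    and sums: "\<And>k. (\<Sum>x\<leftarrow>p. min k x) = min (t * k) n"
  shows "p = almost_equal_partition n t"
proof -
  have pos: "0 \<notin> set p" and n: "sum_list p = n" using p by (auto simp: is_partition_of_def)
  have len: "length p = t" using sums[of 1] sum_list_min_1[OF pos] t by simp
  then have ne: "p \<noteq> []" using t by auto
  let ?l = "last p"
  \<comment> \<open>The inequality is strict at the last part, where the minimum is only
    \<open>?l\<close>.\<close>
  have "(\<Sum>x\<leftarrow>p. min (Suc ?l) x) < (\<Sum>x\<leftarrow>p. Suc ?l)"
    by (rule sum_list_mono_strict_ex[of _ _ _ ?l]) (use ne in auto)
  also have "\<dots> = t * Suc ?l" using len by (simp add: sum_list_triv)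
  finally have "(\<Sum>x\<leftarrow>p. min (Suc ?l) x) = n" using sums[of "Suc ?l"] by (simp add: min_def split: if_splits)
  then have "\<not> (\<Sum>x\<leftarrow>p. min (Suc ?l) x) < (\<Sum>x\<leftarrow>p. x)" using n by simp
  \<comment> \<open>A larger first part would lose something under truncation at
    \<open>Suc ?l\<close>, yet the truncated sum is all of \<open>n\<close>.\<close>
  then have "hd p \<le> Suc ?l"
    using sum_list_mono_strict_ex[of p "min (Suc ?l)" "\<lambda>x. x" "hd p"] ne by force
  then have "is_partition_of n p \<and> length p = t \<and> hd p \<le> last p + 1" using p len by simp
  then show ?thesis
    unfolding almost_equal_partition_def
    by (rule the1_equality[OF ex1_almost_equal_partition[OF t], symmetric])
qed

section \<open>Shapes of nilpotent matrices commuting with \<open>B\<close>\<close>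

lemma kernel_dim_pow_1_block:
  fixes B :: "'a :: field mat"
  assumes B: "B \<in> carrier_mat n n" "nilpotent_mat B" "kernel_dim B = 1"
  shows "kernel_dim (B ^\<^sub>m k) = min k n"
proof -
  note sh = nilpotent_mat_shape[OF B(1,2)]
  have pos: "0 \<notin> set (shape B)" and n: "sum_list (shape B) = n"
    using sh(1) by (auto simp: is_partition_of_def)
  have "B ^\<^sub>m 1 = B" using B(1) by simp
  \<comment> \<open>The dimension of the kernel counts the Jordan blocks.\<close>
  then have "length (shape B) = 1" using sh(2)[of 1] B(3) sum_list_min_1[OF pos] by metis
  then have "shape B = [n]" using n by (cases "shape B") auto
  then show ?thesis using sh(2) by simp
qed

text \<open>Serves both inclusions. The exponent \<open>t\<close> may exceed \<open>n\<close>, while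
  the number of blocks cannot, whence \<open>min t n\<close>.\<close>

lemma shape_commuting:
  fixes A B :: "'a :: field mat"
  assumes A: "A \<in> carrier_mat n n" "nilpotent_mat A" and AB: "A * B = B * A"
    and B: "B \<in> carrier_mat n n" "nilpotent_mat B" "kernel_dim B = 1"
    and ker: "\<And>v. v \<in> carrier_vec n \<Longrightarrow> A *\<^sub>v v = 0\<^sub>v n \<longleftrightarrow> B ^\<^sub>m t *\<^sub>v v = 0\<^sub>v n"
    and n: "1 \<le> n"
  shows "1 \<le> t" and "shape A = almost_equal_partition n (min t n)"
proof -
  have "kernel_dim (A ^\<^sub>m k) = kernel_dim (B ^\<^sub>m (t * k))" for k
    by (rule kernel_dim_cong[OF _ commuting_pow_kernel[OF A(1) B(1) AB ker]]) (use A B in auto)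
  then have sums: "(\<Sum>x\<leftarrow>shape A. min k x) = min (t * k) n" for k
    using nilpotent_mat_shape(2)[OF A, of k] kernel_dim_pow_1_block[OF B] by simp
  note part = nilpotent_mat_shape(1)[OF A]
  have "length (shape A) = min t n"
    using sums[of 1] sum_list_min_1 part by (simp add: is_partition_of_def)
  moreover have "shape A \<noteq> []" using part n by (auto simp: is_partition_of_def)
  ultimately show t: "1 \<le> t" by (cases t) auto
  \<comment> \<open>If \<open>t > n\<close>, both sides are \<open>n\<close> for positive
    \<open>k\<close> and 0 for \<open>k = 0\<close>.\<close>
  have "min (t * k) n = min (min t n * k) n" for k
    using mult_le_mono[of n t 1 k] by (cases k) (auto simp: min_def not_le)
  then show "shape A = almost_equal_partition n (min t n)"
    using almost_equal_partitionI[OF part] t n sums by simp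
qed

theorem proposition1:
  fixes B :: "'a :: field_char_0 mat" and n :: nat
  assumes "n \<ge> 1"
    and "B \<in> carrier_mat n n"
    and "nilpotent_mat B"
    and "kernel_dim B = 1"
  shows "shape ` nilpotent_commutator n B = almost_equal_partitions n"
proof (intro equalityI subsetI)
  fix p assume "p \<in> shape ` nilpotent_commutator n B"
  then obtain A where A: "A \<in> carrier_mat n n" "nilpotent_mat A" "A * B = B * A" "p = shape A"
    by (auto simp: nilpotent_commutator_def)
  obtain t where "\<And>v. v \<in> carrier_vec n \<Longrightarrow> A *\<^sub>v v = 0\<^sub>v n \<longleftrightarrow> B ^\<^sub>m t *\<^sub>v v = 0\<^sub>v n"
    using commuting_kernel_eq_pow_kernel[OF A(1) assms(2) A(3) assms(3,4)] by blast
  from shape_commuting[OF A(1-3) assms(2-4) this assms(1)]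
  show "p \<in> almost_equal_partitions n"
    using A(4) assms(1) by (auto simp: almost_equal_partitions_def)
next
  fix p assume "p \<in> almost_equal_partitions n"
  then obtain t where t: "1 \<le> t" "t \<le> n" "p = almost_equal_partition n t"
    by (auto simp: almost_equal_partitions_def)
  let ?A = "B ^\<^sub>m t"
  have A: "?A \<in> carrier_mat n n" using assms(2) by simp
  have comm: "?A * B = B * ?A" by (rule pow_mat_comm[OF assms(2)])
  have nil: "nilpotent_mat ?A"
  proof -
    obtain k where k: "B ^\<^sub>m k = 0\<^sub>m n n" using assms(2,3) by (auto simp: nilpotent_mat_def)
    \<comment> \<open>Swapping the exponents puts the vanishing power of \<open>B\<close> inside;
      its \<open>t\<close>-th power is zero because \<open>t\<close> is positive.\<close>
    have "?A ^\<^sub>m k = (B ^\<^sub>m k) ^\<^sub>m t" using assms(2) by (simp add: pow_mat_pow mult.commute)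
    also have "\<dots> = 0\<^sub>m n n" using t(1) k by (cases t) auto
    finally show ?thesis using assms(2) by (auto simp: nilpotent_mat_def)
  qed
  \<comment> \<open>For this witness the kernel condition is trivial, and \<open>min t n\<close> is
    \<open>t\<close>.\<close>
  have "shape ?A = almost_equal_partition n (min t n)"
    by (rule shape_commuting(2)[OF A nil comm assms(2-4) _ assms(1)]) simp
  then show "p \<in> shape ` nilpotent_commutator n B"
    using A nil comm t by (auto simp: nilpotent_commutator_def intro!: image_eqI[of _ _ ?A])
qed

end
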